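(* Let $n\ge 1$ and let $X=(X_1,\dots,X_n)\sim\mathcal{N}(0,C)$ be a multivariate Gaussian random vector with covariance matrix $C$ such that $C_{ii}=1$ for all $i$. Define the empirical distribution $$\widehat{F}_n(t)=\frac1n\sum_{i=1}^n\mathbf{1}(\Phi(X_i)\le t),\qquad t\in\mathbb{R}.$$ Then $$\mathbf{E}\sup_{t\in\mathbb{R}}\left|\widehat{F}_n(t)-\mathbf{E}\widehat{F}_n(t)\right|\le 16\sqrt[3]{\frac{n+\Delta}{n^2}},$$ where $\Delta=\sum_{i\ne j}|C_{ij}|$ (sum over ordered pairs $(i,j)$ with $1\le i,j\le n$, $i\neq j$).
   Context: $\Phi$ is the cumulative distribution function of the standard Gaussian $\mathcal{N}(0,1)$, and $\mathbf{1}(A)$ is the indicator of the event $A$. The covariance matrix $C$ is otherwise arbitrary (possibly singular). *)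

theory Defs
  imports "HOL-Probability.Probability"
begin

text \<open>The normal law with mean \<open>m\<close> and variance \<open>v \<ge> 0\<close>; variance zero gives the point mass
  at \<open>m\<close>, which \<^const>\<open>normal_density\<close> does not cover.\<close>

definition gaussian_measure :: "real \<Rightarrow> real \<Rightarrow> real measure" where
  "gaussian_measure m v =
     (if v = 0 then return borel m else density lborel (normal_density m (sqrt v)))"

text \<open>\<open>X \<sim> N(m, C)\<close>, with \<open>C\<close> possibly singular: every linear functional \<open>a \<bullet> X\<close> has the law
  \<open>N(a \<bullet> m, a\<^sup>T C a)\<close>. These laws only see the symmetric part of \<open>C\<close>, so symmetry is required
  separately; then \<open>C\<close> is the covariance matrix of \<open>X\<close>.\<close>

definition gaussian_vector ::
  "'a measure \<Rightarrow> ('a \<Rightarrow> real ^ 'n) \<Rightarrow> real ^ 'n \<Rightarrow> real ^ 'n ^ 'n \<Rightarrow> bool" where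
  "gaussian_vector M X m C \<longleftrightarrow>
     X \<in> borel_measurable M \<and>
     transpose C = C \<and> (\<forall>a. 0 \<le> a \<bullet> (C *v a)) \<and>
     (\<forall>a. distr M borel (\<lambda>\<omega>. a \<bullet> X \<omega>) = gaussian_measure (a \<bullet> m) (a \<bullet> (C *v a)))"

definition std_normal_cdf :: "real \<Rightarrow> real" where
  "std_normal_cdf = cdf std_normal_distribution"

definition empirical_cdf :: "('a \<Rightarrow> real ^ 'n) \<Rightarrow> 'a \<Rightarrow> real \<Rightarrow> real" where
  "empirical_cdf X \<omega> t =
     (\<Sum>i\<in>UNIV. of_bool (std_normal_cdf (X \<omega> $ i) \<le> t)) / real CARD('n)"

definition off_diagonal_sum :: "real ^ 'n ^ 'n \<Rightarrow> real" where
  "off_diagonal_sum C = (\<Sum>(i, j) \<in> {(i, j). i \<noteq> j}. \<bar>C $ i $ j\<bar>)"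

end

theory Submission
  imports Defs
begin

text \<open>
  Write \<open>U\<^sub>i = \<Phi> (X\<^sub>i)\<close>. Each \<open>U\<^sub>i\<close> is uniform on \<open>[0, 1]\<close>, so the mean of the empirical
  distribution function at \<open>t \<in> [0, 1]\<close> is \<open>t\<close>, and its variance is the average of the
  covariances of the indicators \<open>1(U\<^sub>i \<le> t)\<close>.

  The heart of the matter is that these covariances are at most \<open>3 \<bar>C\<^sub>i\<^sub>j\<bar>\<close>, uniformly in \<open>t\<close>
  (\<open>gaussian_pair_threshold_cov\<close>). Write \<open>X\<^sub>j = r X\<^sub>i + s Z\<close> with \<open>r = C\<^sub>i\<^sub>j\<close>, \<open>s = sqrt (1 - r\<^sup>2)\<close> and
  \<open>Z\<close> standard normal and independent of \<open>X\<^sub>i\<close>; then conditioning on \<open>X\<^sub>i = y\<close> moves the threshold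
  for \<open>Z\<close> from \<open>x\<close> to \<open>(x - r y) / s\<close>, which changes the probability by \<open>O(\<bar>r\<bar> (1 + \<bar>y\<bar>))\<close>. The
  independence of \<open>X\<^sub>i\<close> and \<open>Z\<close> has to come from the laws of linear functionals alone. It follows from
  Kac's theorem (\<open>joint_law_eq_product_if_char_factors\<close>), which is derived from the one-dimensional
  uniqueness theorem for characteristic functions by a change of measure.

  Hence the variance at each point is at most \<open>3 a\<^sup>3\<close>, where \<open>a\<close> is the cube root in the theorem.
  Since the empirical distribution function and its mean are monotone, the supremum over all \<open>t\<close> exceeds
  the maximum over a grid of mesh \<open>1 / m\<close> by at most \<open>1 / m\<close>. Bounding the maximum by the sum of
  the squares at the grid points leaves a total of order \<open>1 / m + sqrt (m a\<^sup>3)\<close>, and \<open>m\<close> of order \<open>1 / a\<close>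
  balances the two terms. The resulting constant is \<open>6\<close> (\<open>expectation_deviation_le\<close>).
\<close>

section \<open>Characteristic functions and independence\<close>

text \<open>After adding a constant and normalising, the bounded weight \<open>W\<close> becomes a probability density
  \<open>g\<close>. Since the weight does not correlate with the characters of \<open>X\<close>, reweighting by \<open>g\<close> leaves the
  characteristic function of \<open>X\<close> unchanged, hence its law by Levy's uniqueness theorem. This turns
  uniqueness on the line into a statement about pairs of random variables.\<close>

lemma (in prob_space) uncorrelated_with_characters:
  fixes X W :: "'a \<Rightarrow> real"
  assumes [measurable]: "X \<in> borel_measurable M" "W \<in> borel_measurable M" "A \<in> sets borel"
    and bound: "\<And>\<omega>. \<bar>W \<omega>\<bar> \<le> B"
    and uncorrelated: "\<And>u. (CLINT \<omega>|M. of_real (W \<omega>) * iexp (u * X \<omega>)) =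
      of_real (expectation W) * (CLINT \<omega>|M. iexp (u * X \<omega>))"
  shows "expectation (\<lambda>\<omega>. W \<omega> * indicator A (X \<omega>)) = expectation W * expectation (\<lambda>\<omega>. indicator A (X \<omega>))"
proof -
  have int_W: "integrable M W"
    by (rule integrable_const_bound[where B=B]) (auto simp: bound)
  have int_char: "integrable M (\<lambda>\<omega>. iexp (u * X \<omega>))" for u
    by (rule integrable_const_bound[where B=1]) auto
  have int_W_char: "integrable M (\<lambda>\<omega>. of_real (W \<omega>) * iexp (u * X \<omega>))" for u
    by (rule integrable_const_bound[where B=B]) (auto simp: bound norm_mult)
  have int_ind: "integrable M (\<lambda>\<omega>. indicator A (X \<omega>) :: real)"
    by (rule integrable_const_bound[where B=1]) auto
  have int_W_ind: "integrable M (\<lambda>\<omega>. W \<omega> * indicator A (X \<omega>) :: real)"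
    by (rule integrable_const_bound[where B=B])
      (auto simp: bound indicator_def intro: order_trans[OF abs_ge_zero bound])
  (* The shift by B + 1 (rather than B) keeps the total mass c of the density strictly positive. *)
  define c where "c = expectation W + B + 1"
  have "- B \<le> expectation W"
    using integral_mono[OF _ int_W, of "\<lambda>_. - B"] bound by (auto simp: prob_space abs_le_iff) (metis minus_le_iff)
  hence c: "c > 0" by (simp add: c_def)
  define g where "g = (\<lambda>\<omega>. (W \<omega> + (B + 1)) / c)"
  have [measurable]: "g \<in> borel_measurable M" unfolding g_def by measurable
  have g_nonneg: "0 \<le> g \<omega>" for \<omega>
    using bound[of \<omega>] c by (auto simp: g_def)
  have int_g: "integrable M g" unfolding g_def using int_W by auto
  have "expectation g = 1"
    unfolding g_def using int_W c by (simp add: prob_space c_def)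
  hence "(\<integral>\<^sup>+\<omega>. g \<omega> \<partial>M) = 1"
    using nn_integral_eq_integral[OF int_g] g_nonneg by simp
  define Q where "Q = density M g"
  have "emeasure Q (space Q) = 1"
    using \<open>(\<integral>\<^sup>+\<omega>. g \<omega> \<partial>M) = 1\<close> unfolding Q_def
    by (simp add: emeasure_density)
  interpret Q: prob_space Q by standard fact
  have [measurable_cong]: "sets Q = sets M" by (simp add: Q_def)
  have "char (distr Q borel X) u = char (distr M borel X) u" for u
  proof -
    have "char (distr Q borel X) u = (CLINT \<omega>|M. g \<omega> *\<^sub>R iexp (u * X \<omega>))"
      unfolding char_def Q_def
      by (subst integral_distr) (auto simp: integral_density g_nonneg)
    also have "\<dots> = (CLINT \<omega>|M. (of_real (W \<omega>) * iexp (u * X \<omega>) + of_real (B + 1) * iexp (u * X \<omega>)) / of_real c)"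
      by (intro Bochner_Integration.integral_cong refl)
        (simp add: g_def scaleR_conv_of_real field_simps)
    also have "\<dots> = (of_real (expectation W) * (CLINT \<omega>|M. iexp (u * X \<omega>)) + of_real (B + 1) * (CLINT \<omega>|M. iexp (u * X \<omega>))) / of_real c"
      using int_char int_W_char
      by (subst integral_divide_zero, subst Bochner_Integration.integral_add)
        (auto simp: uncorrelated simp del: of_real_add of_real_mult intro!: integrable_mult_right)
    also have "\<dots> = of_real c * (CLINT \<omega>|M. iexp (u * X \<omega>)) / of_real c"
      by (simp add: c_def algebra_simps)
    also have "\<dots> = char (distr M borel X) u"
      using c unfolding char_def by (subst integral_distr) auto
    finally show ?thesis .
  qed
  hence "distr Q borel X = distr M borel X"
    by (intro Levy_uniqueness) auto
  hence same_law: "(\<integral>x. indicator A x \<partial>distr Q borel X) = (\<integral>x. indicator A x \<partial>distr M borel X :: real)"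
    by simp
  have "expectation (\<lambda>\<omega>. g \<omega> * indicator A (X \<omega>)) = (\<integral>x. indicator A x \<partial>distr Q borel X)"
    unfolding Q_def by (subst integral_distr) (auto simp: integral_density g_nonneg)
  also have "\<dots> = expectation (\<lambda>\<omega>. indicator A (X \<omega>))"
    unfolding same_law by (subst integral_distr) auto
  also have "(\<lambda>\<omega>. g \<omega> * indicator A (X \<omega>)) =
      (\<lambda>\<omega>. (W \<omega> * indicator A (X \<omega>) + (B + 1) * indicator A (X \<omega>)) / c)"
    by (simp add: g_def fun_eq_iff algebra_simps add_divide_distrib)
  finally have "expectation (\<lambda>\<omega>. W \<omega> * indicator A (X \<omega>)) + (B + 1) * expectation (\<lambda>\<omega>. indicator A (X \<omega>))
     = c * expectation (\<lambda>\<omega>. indicator A (X \<omega>))"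
    using int_W_ind int_ind c by (simp add: field_simps)
  thus ?thesis by (simp add: c_def algebra_simps)
qed

text \<open>Kac's theorem. Factorisation of the joint characteristic function says that the real and imaginary
  parts of \<open>exp (i v Z)\<close> do not correlate with the characters of \<open>X\<close>, so they do not correlate with
  the event \<open>X \<in> A\<close> either. Read the other way round, the weight \<open>1(X \<in> A)\<close> does not correlate
  with the characters of \<open>Z\<close>, and a second application of the same lemma gives independence.\<close>

lemma (in prob_space) joint_law_eq_product_if_char_factors:
  fixes X Z :: "'a \<Rightarrow> real"
  assumes [measurable]: "X \<in> borel_measurable M" "Z \<in> borel_measurable M"
    and factors: "\<And>u v. (CLINT \<omega>|M. iexp (u * X \<omega> + v * Z \<omega>)) =
      (CLINT \<omega>|M. iexp (u * X \<omega>)) * (CLINT \<omega>|M. iexp (v * Z \<omega>))"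
  shows "distr M (borel \<Otimes>\<^sub>M borel) (\<lambda>\<omega>. (X \<omega>, Z \<omega>)) = distr M borel X \<Otimes>\<^sub>M distr M borel Z"
proof -
  let ?E = "\<lambda>f. CLINT \<omega>|M. f \<omega>"
  have int_char: "integrable M (\<lambda>\<omega>. iexp (f \<omega>))" if [measurable]: "f \<in> borel_measurable M" for f
    by (rule integrable_const_bound[where B=1]) auto
  have indicator_uncorrelated: "(CLINT \<omega>|M. of_real (indicator A (X \<omega>)) * iexp (v * Z \<omega>)) =
      of_real (expectation (\<lambda>\<omega>. indicator A (X \<omega>))) * (CLINT \<omega>|M. iexp (v * Z \<omega>))"
    if [measurable]: "A \<in> sets borel" for A v
  proof -
    have int_ind: "integrable M (\<lambda>\<omega>. of_real (indicator A (X \<omega>)) * iexp (v * Z \<omega>))"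
      by (rule integrable_const_bound[where B=1]) (auto simp: norm_mult indicator_def)
    have cnj_char: "cnj (iexp x) = iexp (- x)" for x
      by (simp add: exp_cnj)
    (* c = 1 yields the cosine and c = -i the sine. *)
    have part: "expectation (\<lambda>\<omega>. Re (c * iexp (v * Z \<omega>)) * indicator A (X \<omega>)) =
        Re (c * ?E (\<lambda>\<omega>. iexp (v * Z \<omega>))) * expectation (\<lambda>\<omega>. indicator A (X \<omega>))" for c
    proof -
      let ?W = "\<lambda>\<omega>. Re (c * iexp (v * Z \<omega>))"
      have int: "integrable M (\<lambda>\<omega>. d * iexp (u * X \<omega> + w * Z \<omega>))" for d u w
        by (intro integrable_mult_right int_char) measurable
      have E_W: "expectation ?W = Re (c * ?E (\<lambda>\<omega>. iexp (v * Z \<omega>)))"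
        by (subst integral_Re) (auto simp del: of_real_mult intro!: integrable_mult_right int_char)
      have "(CLINT \<omega>|M. of_real (?W \<omega>) * iexp (u * X \<omega>)) =
          of_real (expectation ?W) * ?E (\<lambda>\<omega>. iexp (u * X \<omega>))" for u
      proof -
        have W_char: "of_real (?W \<omega>) * iexp (u * X \<omega>) =
            (c * iexp (u * X \<omega> + v * Z \<omega>) + cnj c * iexp (u * X \<omega> + (- v) * Z \<omega>)) / 2" for \<omega>
        proof -
          have W_eq: "of_real (?W \<omega>) = (c * iexp (v * Z \<omega>) + cnj c * iexp (- (v * Z \<omega>))) / 2"
            using complex_add_cnj[of "c * iexp (v * Z \<omega>)"] cnj_char[of "v * Z \<omega>"]
            by simp
          show ?thesis unfolding W_eq by (simp add: field_simps exp_add exp_diff exp_minus)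
        qed
        have "?E (\<lambda>\<omega>. of_real (?W \<omega>) * iexp (u * X \<omega>)) =
            (c * ?E (\<lambda>\<omega>. iexp (u * X \<omega> + v * Z \<omega>)) + cnj c * ?E (\<lambda>\<omega>. iexp (u * X \<omega> + (- v) * Z \<omega>))) / 2"
          unfolding W_char integral_divide_zero
          by (subst Bochner_Integration.integral_add) (simp_all only: int integral_mult_right_zero)
        also have "\<dots> = (c * ?E (\<lambda>\<omega>. iexp (v * Z \<omega>)) + cnj c * ?E (\<lambda>\<omega>. iexp ((- v) * Z \<omega>))) / 2
            * ?E (\<lambda>\<omega>. iexp (u * X \<omega>))"
          unfolding factors by (simp add: algebra_simps add_divide_distrib)
        also have "?E (\<lambda>\<omega>. iexp ((- v) * Z \<omega>)) = cnj (?E (\<lambda>\<omega>. iexp (v * Z \<omega>)))"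
          by (subst Bochner_Integration.integral_cnj[symmetric]) (simp add: exp_cnj)
        also have "(c * ?E (\<lambda>\<omega>. iexp (v * Z \<omega>)) + cnj c * cnj (?E (\<lambda>\<omega>. iexp (v * Z \<omega>)))) / 2 =
            of_real (expectation ?W)"
          unfolding E_W using complex_add_cnj[of "c * ?E (\<lambda>\<omega>. iexp (v * Z \<omega>))"] by simp
        finally show ?thesis .
      qed
      moreover have "\<bar>?W \<omega>\<bar> \<le> norm c" for \<omega>
        using abs_Re_le_cmod[of "c * iexp (v * Z \<omega>)"] by (simp add: norm_mult)
      ultimately show ?thesis
        unfolding E_W[symmetric] by (intro uncorrelated_with_characters[where B="norm c"]) auto
    qed
    show ?thesis
    proof (rule complex_eqI)
      show "Re (?E (\<lambda>\<omega>. of_real (indicator A (X \<omega>)) * iexp (v * Z \<omega>))) =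
         Re (of_real (expectation (\<lambda>\<omega>. indicator A (X \<omega>))) * ?E (\<lambda>\<omega>. iexp (v * Z \<omega>)))"
        using part[of 1] by (subst integral_Re[OF int_ind, symmetric]) (simp add: mult.commute)
      show "Im (?E (\<lambda>\<omega>. of_real (indicator A (X \<omega>)) * iexp (v * Z \<omega>))) =
         Im (of_real (expectation (\<lambda>\<omega>. indicator A (X \<omega>))) * ?E (\<lambda>\<omega>. iexp (v * Z \<omega>)))"
        using part[of "- \<i>"] by (subst integral_Im[OF int_ind, symmetric]) (simp add: mult.commute)
    qed
  qed
  have product: "prob (X -` A \<inter> space M) * prob (Z -` B \<inter> space M) = prob ((\<lambda>\<omega>. (X \<omega>, Z \<omega>)) -` (A \<times> B) \<inter> space M)"
    if [measurable]: "A \<in> sets borel" "B \<in> sets borel" for A B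
  proof -
    have "expectation (\<lambda>\<omega>. indicat_real A (X \<omega>) * indicat_real B (Z \<omega>)) =
        expectation (\<lambda>\<omega>. indicat_real A (X \<omega>)) * expectation (\<lambda>\<omega>. indicat_real B (Z \<omega>))"
      using indicator_uncorrelated
      by (intro uncorrelated_with_characters[where B=1]) (auto simp: indicator_def)
    moreover have "expectation (\<lambda>\<omega>. indicat_real A (X \<omega>)) = expectation (indicator (X -` A \<inter> space M))"
      "expectation (\<lambda>\<omega>. indicat_real B (Z \<omega>)) = expectation (indicator (Z -` B \<inter> space M))"
      "expectation (\<lambda>\<omega>. indicat_real A (X \<omega>) * indicat_real B (Z \<omega>)) =
        expectation (indicator ((\<lambda>\<omega>. (X \<omega>, Z \<omega>)) -` (A \<times> B) \<inter> space M))"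
      by (rule Bochner_Integration.integral_cong[OF refl]; simp add: indicator_def)+
    ultimately show ?thesis by simp
  qed
  interpret X: real_distribution "distr M borel X" by simp
  interpret Z: real_distribution "distr M borel Z" by simp
  show ?thesis
  proof (rule sym, rule pair_measure_eqI)
    fix A B assume "A \<in> sets (distr M borel X)" "B \<in> sets (distr M borel Z)"
    hence [measurable]: "A \<in> sets borel" "B \<in> sets borel" by auto
    show "emeasure (distr M borel X) A * emeasure (distr M borel Z) B =
        emeasure (distr M (borel \<Otimes>\<^sub>M borel) (\<lambda>\<omega>. (X \<omega>, Z \<omega>))) (A \<times> B)"
      using product[of A B]
      by (simp add: emeasure_distr emeasure_eq_measure flip: ennreal_mult)
  qed (auto intro: X.sigma_finite_measure_axioms Z.sigma_finite_measure_axioms cong: sets_pair_measure_cong)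
qed

section \<open>The standard normal distribution function\<close>

lemma std_normal_cdf_eq: "std_normal_cdf x = measure std_normal_distribution {..x}"
  by (simp add: std_normal_cdf_def cdf_def)

interpretation std_normal: real_distribution std_normal_distribution
  by (rule real_dist_normal_dist)

lemma std_normal_cdf_diff_le:
  assumes "a \<le> b" and dens: "\<And>x. a < x \<Longrightarrow> x \<le> b \<Longrightarrow> std_normal_density x \<le> K" and "0 \<le> K"
  shows "std_normal_cdf b - std_normal_cdf a \<le> K * (b - a)"
proof (cases "a = b")
  case False
  have "ennreal (std_normal_cdf b - std_normal_cdf a) = emeasure std_normal_distribution {a<..b}"
    using assms(1) False unfolding std_normal_cdf_def
    by (subst std_normal.cdf_diff_eq) (auto simp: std_normal.emeasure_eq_measure)
  also have "\<dots> = (\<integral>\<^sup>+x. ennreal (std_normal_density x) * indicator {a<..b} x \<partial>lborel)"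
    by (simp add: emeasure_density)
  also have "\<dots> \<le> (\<integral>\<^sup>+x. ennreal K * indicator {a<..b} x \<partial>lborel)"
    using dens by (intro nn_integral_mono) (auto simp: indicator_def intro!: ennreal_leI)
  also have "\<dots> = ennreal (K * (b - a))"
    using assms by (simp add: nn_integral_cmult_indicator ennreal_mult)
  finally show ?thesis
    using assms by (simp add: ennreal_le_iff)
qed simp

lemma std_normal_density_le_1: "std_normal_density x \<le> 1"
proof -
  have "1 \<le> sqrt (2 * pi)"
    using pi_gt3 by (simp add: real_le_rsqrt)
  have "exp (- x\<^sup>2 / 2) \<le> 1" by simp
  also note \<open>1 \<le> sqrt (2 * pi)\<close>
  finally show ?thesis by (simp add: std_normal_density_def divide_le_eq)
qed

lemma abs_mult_std_normal_density_le_1: "\<bar>x\<bar> * std_normal_density x \<le> 1"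
proof -
  have "1 \<le> sqrt (2 * pi)"
    using pi_gt3 by (simp add: real_le_rsqrt)
  have "2 * \<bar>x\<bar> \<le> x\<^sup>2 + 1\<^sup>2"
    using sum_squares_bound[of "\<bar>x\<bar>" 1] by simp
  hence "\<bar>x\<bar> \<le> 1 + x\<^sup>2 / 2" by simp
  also have "\<dots> \<le> exp (x\<^sup>2 / 2)" by (rule exp_ge_add_one_self)
  finally have "\<bar>x\<bar> * exp (- (x\<^sup>2 / 2)) \<le> 1"
    by (simp add: exp_minus field_simps)
  also note \<open>1 \<le> sqrt (2 * pi)\<close>
  finally show ?thesis by (simp add: std_normal_density_def divide_le_eq)
qed

lemma std_normal_cdf_lipschitz: "\<bar>std_normal_cdf x - std_normal_cdf y\<bar> \<le> \<bar>x - y\<bar>"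
  using std_normal_cdf_diff_le[of x y 1] std_normal_cdf_diff_le[of y x 1] std_normal_density_le_1
    std_normal.cdf_nondecreasing[of x y] std_normal.cdf_nondecreasing[of y x]
  by (fastforce simp: std_normal_cdf_def)

text \<open>The interval between \<open>x\<close> and \<open>c x\<close> has length \<open>(c - 1) \<bar>x\<bar>\<close>, and on it the density is at most
  \<open>1 / \<bar>x\<bar>\<close>. This is what makes the bound uniform in \<open>x\<close>, unlike the Lipschitz bound.\<close>

lemma std_normal_cdf_scale:
  assumes c: "1 \<le> c"
  shows "\<bar>std_normal_cdf (c * x) - std_normal_cdf x\<bar> \<le> c - 1"
proof -
  have decay: "std_normal_density y \<le> 1 / \<bar>x\<bar>" if "\<bar>x\<bar> \<le> \<bar>y\<bar>" "x \<noteq> 0" for y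
  proof -
    have "std_normal_density y * \<bar>x\<bar> \<le> std_normal_density y * \<bar>y\<bar>"
      using that by (intro mult_left_mono) auto
    also have "\<dots> \<le> 1" using abs_mult_std_normal_density_le_1[of y] by (simp add: mult.commute)
    finally show ?thesis using that by (simp add: field_simps)
  qed
  consider "x = 0" | "x > 0" | "x < 0" by linarith
  thus ?thesis
  proof cases
    case 1 thus ?thesis using c by simp
  next
    case 2
    have le: "x \<le> c * x" using 2 c by simp
    have "std_normal_cdf (c * x) - std_normal_cdf x \<le> 1 / \<bar>x\<bar> * (c * x - x)"
      using 2 le by (intro std_normal_cdf_diff_le decay) auto
    also have "\<dots> = c - 1" using 2 by (simp add: field_simps)
    finally show ?thesis
      using std_normal.cdf_nondecreasing[OF le] by (simp add: std_normal_cdf_def)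
  next
    case 3
    have le: "c * x \<le> x" using 3 c by (simp add: mult_le_cancel_right1)
    have "std_normal_cdf x - std_normal_cdf (c * x) \<le> 1 / \<bar>x\<bar> * (x - c * x)"
      using 3 le by (intro std_normal_cdf_diff_le decay) auto
    also have "\<dots> = c - 1" using 3 by (simp add: field_simps)
    finally show ?thesis
      using std_normal.cdf_nondecreasing[OF le] by (simp add: std_normal_cdf_def)
  qed
qed

lemma continuous_std_normal_cdf: "isCont std_normal_cdf x"
  unfolding isCont_def tendsto_iff
proof safe
  fix e :: real assume "e > 0"
  have "\<forall>\<^sub>F y in at x. dist y x < e"
    using \<open>e > 0\<close> by (auto simp: eventually_at)
  thus "\<forall>\<^sub>F y in at x. dist (std_normal_cdf y) (std_normal_cdf x) < e"
    by eventually_elim (use std_normal_cdf_lipschitz[of _ x] in \<open>auto simp: dist_real_def intro: le_less_trans\<close>)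
qed

text \<open>By monotonicity and continuity a sublevel set is a closed lower set. Arguing with these sets
  replaces the inverse of the distribution function, and covers the levels \<open>0\<close> and \<open>1\<close>, which a
  distribution function need not attain.\<close>

lemma (in real_distribution) cdf_sublevel_cases:
  assumes cont: "\<And>x. isCont (cdf M) x"
  obtains "{x. cdf M x \<le> t} = {}" | "{x. cdf M x \<le> t} = UNIV" | x where "{x. cdf M x \<le> t} = {..x}"
proof (cases "{x. cdf M x \<le> t} \<noteq> {} \<and> {x. cdf M x \<le> t} \<noteq> UNIV")
  case True
  let ?S = "{x. cdf M x \<le> t}"
  from True obtain b where "t < cdf M b" by auto (metis linorder_not_le)
  hence "x \<le> b" if "cdf M x \<le> t" for x
    using cdf_nondecreasing[of b x] that by linarith
  hence "bdd_above ?S" by (auto simp: bdd_above_def)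
  moreover have "closed ?S"
    using cont by (intro closed_Collect_le continuous_intros) (auto simp: continuous_on_eq_continuous_at)
  ultimately have "Sup ?S \<in> ?S" using True by (intro closed_contains_Sup) auto
  have "?S = {..Sup ?S}"
  proof safe
    fix x assume "cdf M x \<le> t"
    thus "x \<le> Sup ?S" using \<open>bdd_above ?S\<close> by (intro cSup_upper) auto
  next
    fix x assume "x \<le> Sup ?S"
    thus "cdf M x \<le> t" using cdf_nondecreasing[of x "Sup ?S"] \<open>Sup ?S \<in> ?S\<close> by auto
  qed
  thus ?thesis using that(3) by blast
qed (use that in auto)

text \<open>The probability integral transform: a variable with continuous distribution function, inserted
  into that function, is uniform on the unit interval.\<close>

lemma (in real_distribution) cdf_sublevel_measure:
  assumes cont: "\<And>x. isCont (cdf M) x" and t: "0 \<le> t" "t \<le> 1"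
  shows "prob {x. cdf M x \<le> t} = t"
proof (rule cdf_sublevel_cases[OF cont, of t])
  assume empty: "{x. cdf M x \<le> t} = {}"
  hence "t \<le> cdf M x" for x by (auto simp: not_le intro: less_imp_le)
  hence "t \<le> 0" using cdf_lim_at_bot by (intro tendsto_lowerbound[where F=at_bot]) auto
  thus ?thesis using t empty by simp
next
  assume univ: "{x. cdf M x \<le> t} = UNIV"
  hence "cdf M x \<le> t" for x by auto
  hence "1 \<le> t" using cdf_lim_at_top_prob by (intro tendsto_upperbound[where F=at_top]) auto
  thus ?thesis unfolding univ using t prob_space by simp
next
  fix x assume sublevel: "{x. cdf M x \<le> t} = {..x}"
  have "t \<le> cdf M y" if "y \<in> {x<..}" for y
    using sublevel that by (auto simp: set_eq_iff not_le) (meson linorder_not_le less_imp_le)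
  moreover have "(cdf M \<longlongrightarrow> cdf M x) (at_right x)"
    using cdf_is_right_cont[of x] by (simp add: continuous_within)
  ultimately have "t \<le> cdf M x"
    by (intro tendsto_lowerbound[where F="at_right x"]) (auto simp: eventually_at_filter)
  moreover have "cdf M x \<le> t" using sublevel by auto
  ultimately have "cdf M x = t" by simp
  thus ?thesis unfolding sublevel by (simp add: cdf_def)
qed

section \<open>Pairs of components of a Gaussian vector\<close>

lemma gaussian_vector_char:
  fixes X :: "'a \<Rightarrow> real ^ 'n"
  assumes "prob_space M" and X: "gaussian_vector M X 0 C"
  shows "(CLINT \<omega>|M. iexp (a \<bullet> X \<omega>)) = of_real (exp (- (a \<bullet> (C *v a)) / 2))"
proof -
  interpret prob_space M by fact
  let ?q = "\<lambda>a. a \<bullet> (C *v a)"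
  have X_meas [measurable]: "X \<in> borel_measurable M"
    and law: "distr M borel (\<lambda>\<omega>. a \<bullet> X \<omega>) = gaussian_measure 0 (?q a)" and q: "0 \<le> ?q a" for a
    using X by (auto simp: gaussian_vector_def)
  have char_law: "(CLINT \<omega>|M. iexp (t * (a \<bullet> X \<omega>))) = char (gaussian_measure 0 (?q a)) t" for a t
    unfolding char_def law[symmetric] by (subst integral_distr) auto
  show ?thesis
  proof (cases "?q a = 0")
    case True
    have "(CLINT \<omega>|M. iexp (1 * (a \<bullet> X \<omega>))) = 1"
      unfolding char_law True gaussian_measure_def char_def by (simp add: integral_return)
    thus ?thesis using True by simp
  next
    case False
    define s where "s = sqrt (?q a)"
    have s: "s > 0" "s\<^sup>2 = ?q a" using False q[of a] by (auto simp: s_def)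
    (* Rescaling a to unit variance reduces the claim to the standard normal characteristic function. *)
    define b where "b = (1 / s) *\<^sub>R a"
    have "?q b = ?q a / s\<^sup>2"
      by (simp add: b_def matrix_vector_mult_scaleR power2_eq_square)
    hence qb: "?q b = 1" using s False by simp
    have "(CLINT \<omega>|M. iexp (a \<bullet> X \<omega>)) = (CLINT \<omega>|M. iexp (s * (b \<bullet> X \<omega>)))"
      using s by (simp add: b_def)
    also have "\<dots> = of_real (exp (- s\<^sup>2 / 2))"
      unfolding char_law qb by (simp add: gaussian_measure_def char_std_normal_distribution)
    finally show ?thesis using s by simp
  qed
qed

text \<open>The definition of a Gaussian vector only speaks about the laws of linear functionals. They
  determine the joint characteristic function of \<open>X\<^sub>i\<close> and the normalised residual \<open>Z\<close> of the
  regression of \<open>X\<^sub>j\<close> on \<open>X\<^sub>i\<close>. The residual has variance one and covariance zero with \<open>X\<^sub>i\<close>, so this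
  function factorises.\<close>

lemma gaussian_vector_pair_law:
  fixes X :: "'a \<Rightarrow> real ^ 'n"
  assumes M: "prob_space M" and X: "gaussian_vector M X 0 C"
    and diag: "C $ i $ i = 1" "C $ j $ j = 1" and "i \<noteq> j"
    and r: "\<bar>C $ i $ j\<bar> < 1"
  defines "Z \<equiv> \<lambda>\<omega>. (X \<omega> $ j - C $ i $ j * X \<omega> $ i) / sqrt (1 - (C $ i $ j)\<^sup>2)"
  shows "distr M (borel \<Otimes>\<^sub>M borel) (\<lambda>\<omega>. (X \<omega> $ i, Z \<omega>)) =
    std_normal_distribution \<Otimes>\<^sub>M std_normal_distribution"
proof -
  interpret prob_space M by fact
  define r where "r = C $ i $ j"
  define s where "s = sqrt (1 - r\<^sup>2)"
  have "r\<^sup>2 < 1" using r by (simp add: r_def abs_square_less_1)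
  hence s: "s > 0" "s\<^sup>2 = 1 - r\<^sup>2" by (auto simp: s_def)
  have X_meas [measurable]: "X \<in> borel_measurable M"
    and sym: "transpose C = C"
    using X by (auto simp: gaussian_vector_def)
  have [measurable]: "(\<lambda>\<omega>. X \<omega> $ k) \<in> borel_measurable M" for k
    using borel_measurable_inner[OF X_meas, of "\<lambda>_. axis k 1"] by (simp add: inner_axis)
  have Z_eq: "Z = (\<lambda>\<omega>. (X \<omega> $ j - r * X \<omega> $ i) / s)"
    by (simp add: Z_def r_def s_def)
  have [measurable]: "Z \<in> borel_measurable M" unfolding Z_eq by measurable
  have rji: "C $ j $ i = r" using sym by (metis r_def transpose_def vec_lambda_beta)
  have char: "(CLINT \<omega>|M. iexp (u * X \<omega> $ i + v * Z \<omega>)) = of_real (exp (- (u\<^sup>2 + v\<^sup>2) / 2))" for u v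
  proof -
    define \<alpha> where "\<alpha> = u - v * r / s"
    define \<beta> where "\<beta> = v / s"
    define a :: "real ^ 'n" where "a = \<alpha> *\<^sub>R axis i 1 + \<beta> *\<^sub>R axis j 1"
    have aX: "a \<bullet> X \<omega> = u * X \<omega> $ i + v * Z \<omega>" for \<omega>
      by (simp add: a_def Z_eq inner_add_left inner_axis' \<alpha>_def \<beta>_def algebra_simps diff_divide_distrib)
    have col: "C *v axis k 1 = column k C" for k
      by (rule matrix_vector_mult_basis)
    have "a \<bullet> (C *v a) = \<alpha>\<^sup>2 + 2 * \<alpha> * \<beta> * r + \<beta>\<^sup>2"
      using diag
      by (simp add: a_def matrix_vector_right_distrib matrix_vector_mult_scaleR col inner_add_left inner_add_right
          inner_axis' column_def r_def[symmetric] rji power2_eq_square algebra_simps)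
    also have "\<dots> = (\<alpha> + \<beta> * r)\<^sup>2 + \<beta>\<^sup>2 * s\<^sup>2"
      unfolding s by (simp add: power2_eq_square algebra_simps)
    also have "\<dots> = u\<^sup>2 + v\<^sup>2" using s(1) by (simp add: \<alpha>_def \<beta>_def power_divide)
    finally show ?thesis
      using gaussian_vector_char[OF M X, of a] by (simp add: aX)
  qed
  have char_X: "(CLINT \<omega>|M. iexp (u * X \<omega> $ i)) = of_real (exp (- u\<^sup>2 / 2))" for u
    using char[of u 0] by simp
  have char_Z: "(CLINT \<omega>|M. iexp (v * Z \<omega>)) = of_real (exp (- v\<^sup>2 / 2))" for v
    using char[of 0 v] by simp
  have "distr M borel (\<lambda>\<omega>. X \<omega> $ i) = std_normal_distribution"
    by (rule Levy_uniqueness) (auto simp: char_std_normal_distribution char_def[of "distr _ _ _"]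
      integral_distr char_X simp del: of_real_mult intro: real_dist_normal_dist)
  moreover have "distr M borel Z = std_normal_distribution"
    by (rule Levy_uniqueness) (auto simp: char_std_normal_distribution char_def[of "distr _ _ _"]
      integral_distr char_Z simp del: of_real_mult intro: real_dist_normal_dist)
  moreover have "distr M (borel \<Otimes>\<^sub>M borel) (\<lambda>\<omega>. (X \<omega> $ i, Z \<omega>)) =
     distr M borel (\<lambda>\<omega>. X \<omega> $ i) \<Otimes>\<^sub>M distr M borel Z"
    by (rule joint_law_eq_product_if_char_factors)
      (auto simp: char char_X char_Z exp_add[symmetric] add_divide_distrib simp del: of_real_mult of_real_add simp flip: of_real_mult)
  ultimately show ?thesis by simp
qed

lemma halfplanes_measurable:
  "{(y, z). y \<le> x \<and> r * y + s * z \<le> x} \<in> sets (borel \<Otimes>\<^sub>M borel :: (real \<times> real) measure)"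
proof -
  have "{p \<in> space (borel \<Otimes>\<^sub>M borel). fst p \<le> x \<and> r * fst p + s * snd p \<le> x} \<in>
      sets (borel \<Otimes>\<^sub>M borel :: (real \<times> real) measure)"
    by measurable
  thus ?thesis by (simp add: space_pair_measure case_prod_beta')
qed

text \<open>For independent standard normal \<open>Y\<close> and \<open>Z\<close>, let \<open>Y' = r Y + s Z\<close>. Conditionally on \<open>Y = y\<close>, the
  event \<open>Y' \<le> x\<close> has probability \<open>\<Phi> ((x - r y) / s)\<close> instead of \<open>\<Phi> x\<close>. Moving from \<open>x\<close> to \<open>x / s\<close>
  costs at most \<open>1 / s - 1 \<le> \<bar>r\<bar>\<close>, and the remaining shift by \<open>r y / s\<close> costs at most
  \<open>\<bar>r\<bar> \<bar>y\<bar> / s \<le> 2 \<bar>r\<bar> \<bar>y\<bar>\<close>, and the first absolute moment of \<open>Y\<close> is at most one.\<close>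

lemma std_normal_pair_cov_bound:
  fixes r x :: real
  assumes r: "\<bar>r\<bar> \<le> 1 / 2"
  defines "s \<equiv> sqrt (1 - r\<^sup>2)"
  shows "\<bar>measure (std_normal_distribution \<Otimes>\<^sub>M std_normal_distribution)
      {(y, z). y \<le> x \<and> r * y + s * z \<le> x} - (std_normal_cdf x)\<^sup>2\<bar> \<le> 3 * \<bar>r\<bar>"
proof -
  let ?N = "std_normal_distribution"
  interpret P: pair_prob_space ?N ?N ..
  have r2: "r\<^sup>2 \<le> \<bar>r\<bar> / 2"
    using mult_left_mono[OF r, of "\<bar>r\<bar>"] by (simp add: power2_eq_square)
  have r2': "r\<^sup>2 \<le> 1 / 4" using r2 r by linarith
  have s_pos: "s > 0" using r2' by (simp add: s_def)
  have s_le: "s \<le> 1" by (simp add: s_def)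
  have "1 - r\<^sup>2 = s\<^sup>2" using r2' by (simp add: s_def)
  also have "\<dots> \<le> s" using s_pos s_le by (simp add: power2_eq_square mult_left_le)
  finally have s_ge: "1 - r\<^sup>2 \<le> s" .
  have inv_s: "1 / s \<le> 1 + \<bar>r\<bar>" "1 / s \<le> 2" "1 \<le> 1 / s"
  proof -
    have "1 \<le> (1 + \<bar>r\<bar>) * (1 - \<bar>r\<bar> / 2)"
      using r mult_left_mono[OF r, of "\<bar>r\<bar>"] by (simp add: algebra_simps)
    also have "\<dots> \<le> (1 + \<bar>r\<bar>) * s" using s_ge r2 by (intro mult_left_mono) auto
    finally show "1 / s \<le> 1 + \<bar>r\<bar>" using s_pos by (simp add: divide_le_eq)
    thus "1 / s \<le> 2" using r by linarith
    show "1 \<le> 1 / s" using s_pos s_le by simp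
  qed
  let ?S = "{(y, z). y \<le> x \<and> r * y + s * z \<le> x}"
  have S_sets [measurable]: "?S \<in> sets (?N \<Otimes>\<^sub>M ?N)"
  proof -
    have "sets (?N \<Otimes>\<^sub>M ?N) = sets (borel \<Otimes>\<^sub>M borel)"
      by (intro sets_pair_measure_cong) auto
    thus ?thesis using halfplanes_measurable by simp
  qed
  have cdf_meas [measurable]: "std_normal_cdf \<in> borel_measurable borel"
    by (intro borel_measurable_continuous_onI continuous_at_imp_continuous_on ballI continuous_std_normal_cdf)
  have cdf_01: "0 \<le> std_normal_cdf y" "std_normal_cdf y \<le> 1" for y
    by (auto simp: std_normal_cdf_def std_normal.cdf_nonneg std_normal.cdf_bounded_prob)
  have int_part: "integrable ?N (\<lambda>y. indicator {..x} y * std_normal_cdf (f y))"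
    if [measurable]: "f \<in> borel_measurable borel" for f
    by (rule std_normal.integrable_const_bound[where B=1])
      (auto simp: indicator_def cdf_01)
  have "measure (?N \<Otimes>\<^sub>M ?N) ?S = (\<integral>p. indicator ?S p \<partial>(?N \<Otimes>\<^sub>M ?N))"
    by (simp add: space_pair_measure)
  also have "\<dots> = (\<integral>y. \<integral>z. indicator ?S (y, z) \<partial>?N \<partial>?N)"
    by (rule P.integral_fst'[symmetric]) (rule P.integrable_const_bound[where B=1], auto)
  also have "\<dots> = (\<integral>y. indicator {..x} y * std_normal_cdf ((x - r * y) / s) \<partial>?N)"
  proof (intro Bochner_Integration.integral_cong refl)
    fix y
    have "(\<lambda>z. indicator ?S (y, z) :: real) = (\<lambda>z. indicator {..x} y * indicator {..(x - r * y) / s} z)"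
      using s_pos by (auto simp: fun_eq_iff indicator_def field_simps)
    thus "(\<integral>z. indicator ?S (y, z) \<partial>?N) = indicator {..x} y * std_normal_cdf ((x - r * y) / s)"
      by (simp add: std_normal_cdf_eq)
  qed
  finally have joint: "measure (?N \<Otimes>\<^sub>M ?N) ?S = (\<integral>y. indicator {..x} y * std_normal_cdf ((x - r * y) / s) \<partial>?N)" .
  have square: "(std_normal_cdf x)\<^sup>2 = (\<integral>y. indicator {..x} y * std_normal_cdf x \<partial>?N)"
    by (simp add: std_normal_cdf_eq power2_eq_square)
  have int_abs: "integrable ?N (\<lambda>y. \<bar>y\<bar>)"
    using integrable_std_normal_distribution_moment[of 1] by (simp add: integrable_abs)
  have int_sq: "integrable ?N (\<lambda>y. y\<^sup>2)"
    by (rule integrable_std_normal_distribution_moment)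
  have "(\<integral>y. \<bar>y\<bar> \<partial>?N) \<le> (\<integral>y. (1 + y\<^sup>2) / 2 \<partial>?N)"
  proof (rule integral_mono)
    show "\<bar>y\<bar> \<le> (1 + y\<^sup>2) / 2" for y :: real
      using sum_squares_bound[of "\<bar>y\<bar>" 1] by simp
  qed (use int_abs int_sq in auto)
  also have "\<dots> = 1"
    using int_sq std_normal_distribution_even_moments(1)[of 1] std_normal.prob_space
    by (simp add: fact_numeral)
  finally have abs_moment: "(\<integral>y. \<bar>y\<bar> \<partial>?N) \<le> 1" .
  have shift: "\<bar>std_normal_cdf ((x - r * y) / s) - std_normal_cdf x\<bar> \<le> \<bar>r\<bar> / s * \<bar>y\<bar> + (1 / s - 1)" for y
  proof -
    have "\<bar>std_normal_cdf ((x - r * y) / s) - std_normal_cdf (1 / s * x)\<bar> \<le> \<bar>(x - r * y) / s - 1 / s * x\<bar>"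
      by (rule std_normal_cdf_lipschitz)
    also have "\<dots> = \<bar>r\<bar> / s * \<bar>y\<bar>"
      using s_pos by (simp add: diff_divide_distrib abs_mult)
    finally show ?thesis
      using std_normal_cdf_scale[OF inv_s(3), of x] by linarith
  qed
  have "\<bar>measure (?N \<Otimes>\<^sub>M ?N) ?S - (std_normal_cdf x)\<^sup>2\<bar>
     = \<bar>\<integral>y. indicator {..x} y * std_normal_cdf ((x - r * y) / s) - indicator {..x} y * std_normal_cdf x \<partial>?N\<bar>"
    unfolding joint square
    by (subst Bochner_Integration.integral_diff, (rule int_part, measurable)+)
  also have "\<dots> \<le> (\<integral>y. \<bar>indicator {..x} y * std_normal_cdf ((x - r * y) / s) - indicator {..x} y * std_normal_cdf x\<bar> \<partial>?N)"
    by (rule integral_abs_bound)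
  also have "\<dots> \<le> (\<integral>y. \<bar>r\<bar> / s * \<bar>y\<bar> + (1 / s - 1) \<partial>?N)"
  proof (rule integral_mono)
    fix y
    show "\<bar>indicator {..x} y * std_normal_cdf ((x - r * y) / s) - indicator {..x} y * std_normal_cdf x\<bar>
        \<le> \<bar>r\<bar> / s * \<bar>y\<bar> + (1 / s - 1)"
      using shift[of y] abs_ge_zero[of "std_normal_cdf ((x - r * y) / s) - std_normal_cdf x"]
      by (auto simp: indicator_def simp del: abs_ge_zero)
  qed (use int_abs in \<open>auto intro!: int_part integrable_abs Bochner_Integration.integrable_diff Bochner_Integration.integrable_add integrable_mult_right\<close>)
  also have "\<dots> = \<bar>r\<bar> / s * (\<integral>y. \<bar>y\<bar> \<partial>?N) + (1 / s - 1)"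
    using int_abs std_normal.prob_space by simp
  also have "\<dots> \<le> \<bar>r\<bar> * (1 / s) * 1 + \<bar>r\<bar>"
    using abs_moment inv_s(1) s_pos by (intro add_mono) (auto intro!: divide_right_mono mult_left_le)
  also have "\<dots> \<le> \<bar>r\<bar> * 2 * 1 + \<bar>r\<bar>"
    using inv_s(2) by (intro add_mono mult_right_mono mult_left_mono) auto
  finally show ?thesis by simp
qed

lemma gaussian_vector_marginal:
  fixes X :: "'a \<Rightarrow> real ^ 'n"
  assumes X: "gaussian_vector M X 0 C" and diag: "C $ i $ i = 1"
  shows "distr M borel (\<lambda>\<omega>. X \<omega> $ i) = std_normal_distribution"
proof -
  have "distr M borel (\<lambda>\<omega>. axis i 1 \<bullet> X \<omega>) = gaussian_measure 0 (axis i 1 \<bullet> (C *v axis i 1))"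
    using X unfolding gaussian_vector_def by (metis inner_zero_right)
  thus ?thesis
    by (simp add: inner_axis' matrix_vector_mult_basis column_def diag gaussian_measure_def)
qed

text \<open>For correlations up to one half this is the preceding bound, with \<open>X\<^sub>j = r X\<^sub>i + s Z\<close>. Larger
  correlations, including the singular case \<open>\<bar>r\<bar> = 1\<close> in which no residual exists, are covered by the
  trivial bound \<open>1 \<le> 3 \<bar>r\<bar>\<close>.\<close>

lemma gaussian_pair_threshold_cov:
  fixes X :: "'a \<Rightarrow> real ^ 'n"
  assumes M: "prob_space M" and X: "gaussian_vector M X 0 C" and diag: "\<And>i. C $ i $ i = 1"
    and "i \<noteq> j"
  shows "\<bar>measure M {\<omega>\<in>space M. X \<omega> $ i \<le> x \<and> X \<omega> $ j \<le> x} - (std_normal_cdf x)\<^sup>2\<bar> \<le> 3 * \<bar>C $ i $ j\<bar>"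
proof -
  interpret prob_space M by fact
  define r where "r = C $ i $ j"
  have X_meas [measurable]: "X \<in> borel_measurable M"
    using X by (auto simp: gaussian_vector_def)
  have [measurable]: "(\<lambda>\<omega>. X \<omega> $ k) \<in> borel_measurable M" for k
    using borel_measurable_inner[OF X_meas, of "\<lambda>_. axis k 1"] by (simp add: inner_axis)
  show ?thesis
  proof (cases "\<bar>r\<bar> \<le> 1 / 2")
    case False
    have "(std_normal_cdf x)\<^sup>2 \<le> 1"
      by (simp add: std_normal_cdf_def std_normal.cdf_nonneg std_normal.cdf_bounded_prob power_le_one)
    moreover have "prob {\<omega>\<in>space M. X \<omega> $ i \<le> x \<and> X \<omega> $ j \<le> x} \<le> 1" by simp
    ultimately have "\<bar>prob {\<omega>\<in>space M. X \<omega> $ i \<le> x \<and> X \<omega> $ j \<le> x} - (std_normal_cdf x)\<^sup>2\<bar> \<le> 1"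
      using measure_nonneg[of M "{\<omega>\<in>space M. X \<omega> $ i \<le> x \<and> X \<omega> $ j \<le> x}"] zero_le_power2[of "std_normal_cdf x"]
      by linarith
    thus ?thesis using False by (simp add: r_def)
  next
    case True
    define s where "s = sqrt (1 - r\<^sup>2)"
    have "r\<^sup>2 < 1" using True by (simp add: abs_square_less_1)
    hence s: "s > 0" by (simp add: s_def)
    define Z where "Z = (\<lambda>\<omega>. (X \<omega> $ j - r * X \<omega> $ i) / s)"
    have [measurable]: "Z \<in> borel_measurable M" unfolding Z_def by measurable
    have law: "distr M (borel \<Otimes>\<^sub>M borel) (\<lambda>\<omega>. (X \<omega> $ i, Z \<omega>)) =
        std_normal_distribution \<Otimes>\<^sub>M std_normal_distribution"
      unfolding Z_def s_def r_def using True assms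
      by (intro gaussian_vector_pair_law) (auto simp: r_def)
    have S: "{(y, z). y \<le> x \<and> r * y + s * z \<le> x} \<in> sets (borel \<Otimes>\<^sub>M borel :: (real \<times> real) measure)"
      by (rule halfplanes_measurable)
    have "measure (std_normal_distribution \<Otimes>\<^sub>M std_normal_distribution) {(y, z). y \<le> x \<and> r * y + s * z \<le> x} =
        prob ((\<lambda>\<omega>. (X \<omega> $ i, Z \<omega>)) -` {(y, z). y \<le> x \<and> r * y + s * z \<le> x} \<inter> space M)"
      unfolding law[symmetric] using S by (intro measure_distr) auto
    also have "(\<lambda>\<omega>. (X \<omega> $ i, Z \<omega>)) -` {(y, z). y \<le> x \<and> r * y + s * z \<le> x} \<inter> space M =
        {\<omega>\<in>space M. X \<omega> $ i \<le> x \<and> X \<omega> $ j \<le> x}"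
      using s by (auto simp: Z_def)
    finally show ?thesis
      using std_normal_pair_cov_bound[OF True, of x] by (simp add: s_def r_def)
  qed
qed

section \<open>The empirical distribution function at a fixed point\<close>

locale standardised_gaussian_vector = prob_space M for M :: "'a measure" +
  fixes X :: "'a \<Rightarrow> real ^ 'n" and C :: "real ^ 'n ^ 'n"
  assumes gaussian: "gaussian_vector M X 0 C" and unit_variance: "\<And>i. C $ i $ i = 1"
begin

definition U :: "'n \<Rightarrow> 'a \<Rightarrow> real" where
  "U i \<omega> = std_normal_cdf (X \<omega> $ i)"

abbreviation F :: "'a \<Rightarrow> real \<Rightarrow> real" where "F \<equiv> empirical_cdf X"

lemma F_eq: "F \<omega> t = (\<Sum>i\<in>UNIV. of_bool (U i \<omega> \<le> t)) / CARD('n)"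
  by (simp add: empirical_cdf_def U_def)

lemma component_measurable [measurable]: "(\<lambda>\<omega>. X \<omega> $ k) \<in> borel_measurable M"
proof -
  have [measurable]: "X \<in> borel_measurable M"
    using gaussian by (auto simp: gaussian_vector_def)
  have "(\<lambda>\<omega>. X \<omega> \<bullet> axis k 1) \<in> borel_measurable M" by measurable
  thus ?thesis by (simp add: inner_axis)
qed

lemma U_measurable [measurable]: "U i \<in> borel_measurable M"
proof -
  have [measurable]: "std_normal_cdf \<in> borel_measurable borel"
    by (intro borel_measurable_continuous_onI continuous_at_imp_continuous_on ballI continuous_std_normal_cdf)
  show ?thesis unfolding U_def by measurable
qed

lemma U_bounds: "0 \<le> U i \<omega>" "U i \<omega> \<le> 1"
  by (auto simp: U_def std_normal_cdf_def std_normal.cdf_nonneg std_normal.cdf_bounded_prob)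

lemma prob_component: "A \<in> sets borel \<Longrightarrow> prob {\<omega>\<in>space M. X \<omega> $ i \<in> A} = measure std_normal_distribution A"
  unfolding gaussian_vector_marginal[OF gaussian unit_variance, of i, symmetric]
  by (subst measure_distr) (auto intro!: arg_cong[where f=prob])

lemma U_uniform:
  assumes "0 \<le> t" "t \<le> 1"
  shows "prob {\<omega>\<in>space M. U i \<omega> \<le> t} = t"
proof -
  have cont: "isCont (cdf std_normal_distribution) x" for x
    using continuous_std_normal_cdf by (simp add: std_normal_cdf_def)
  have "closed {x. std_normal_cdf x \<le> t}"
    by (intro closed_Collect_le continuous_intros continuous_at_imp_continuous_on ballI continuous_std_normal_cdf)
  hence "prob {\<omega>\<in>space M. X \<omega> $ i \<in> {x. std_normal_cdf x \<le> t}} = measure std_normal_distribution {x. std_normal_cdf x \<le> t}"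
    by (intro prob_component) simp
  thus ?thesis
    using std_normal.cdf_sublevel_measure[OF cont assms] by (simp add: U_def std_normal_cdf_def)
qed

text \<open>The event \<open>U\<^sub>i \<le> t\<close> is either trivial or a threshold event for \<open>X\<^sub>i\<close>, with the same threshold for all
  components, so the covariance bound for Gaussian pairs applies.\<close>

lemma U_threshold_cov:
  assumes "i \<noteq> j" "0 \<le> t" "t \<le> 1"
  shows "\<bar>prob {\<omega>\<in>space M. U i \<omega> \<le> t \<and> U j \<omega> \<le> t} - t\<^sup>2\<bar> \<le> 3 * \<bar>C $ i $ j\<bar>"
proof -
  have cont: "isCont (cdf std_normal_distribution) x" for x
    using continuous_std_normal_cdf by (simp add: std_normal_cdf_def)
  note measure_sublevel = std_normal.cdf_sublevel_measure[OF cont assms(2,3)]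
  have U_le: "U k \<omega> \<le> t \<longleftrightarrow> X \<omega> $ k \<in> {x. cdf std_normal_distribution x \<le> t}" for k \<omega>
    by (simp add: U_def std_normal_cdf_def)
  show ?thesis
  proof (rule std_normal.cdf_sublevel_cases[OF cont, of t])
    assume "{x. cdf std_normal_distribution x \<le> t} = {}"
    thus ?thesis using measure_sublevel unfolding U_le by simp
  next
    assume univ: "{x. cdf std_normal_distribution x \<le> t} = UNIV"
    hence "t = 1" using measure_sublevel std_normal.prob_space by simp
    thus ?thesis using prob_space unfolding U_le univ by simp
  next
    fix x assume sublevel: "{x. cdf std_normal_distribution x \<le> t} = {..x}"
    hence "std_normal_cdf x = t" using measure_sublevel by (simp add: std_normal_cdf_eq)
    thus ?thesis
      using gaussian_pair_threshold_cov[OF prob_space_axioms gaussian unit_variance assms(1), of x]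
      unfolding U_le sublevel by simp
  qed
qed

lemma expectation_F:
  "expectation (\<lambda>\<omega>. F \<omega> t) = min 1 (max 0 t)"
proof -
  have E_bool: "expectation (\<lambda>\<omega>. of_bool (U i \<omega> \<le> t)) = min 1 (max 0 t)" for i
  proof -
    have "expectation (\<lambda>\<omega>. of_bool (U i \<omega> \<le> t)) = expectation (indicat_real {\<omega>\<in>space M. U i \<omega> \<le> t})"
      by (rule Bochner_Integration.integral_cong[OF refl]) (simp add: indicator_def)
    also have "\<dots> = prob {\<omega>\<in>space M. U i \<omega> \<le> t}" by simp
    also have "\<dots> = min 1 (max 0 t)"
    proof -
      consider "t < 0" | "0 \<le> t" "t \<le> 1" | "t > 1" by linarith
      thus ?thesis
      proof cases
        case 1
        hence empty: "{\<omega>\<in>space M. U i \<omega> \<le> t} = {}" using less_le_trans[OF _ U_bounds(1)[of i]] by (auto simp: not_le)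
        show ?thesis unfolding empty using 1 by simp
      next
        case 2 thus ?thesis using U_uniform[of t i] by simp
      next
        case 3
        hence full: "{\<omega>\<in>space M. U i \<omega> \<le> t} = space M"
          using order_trans[OF U_bounds(2)[of i]] by auto
        show ?thesis unfolding full using 3 prob_space by simp
      qed
    qed
    finally show ?thesis .
  qed
  have "integrable M (\<lambda>\<omega>. of_bool (U i \<omega> \<le> t) :: real)" for i
    by (rule integrable_const_bound[where B=1]) auto
  thus ?thesis by (simp add: F_eq E_bool del: sum_of_bool_eq)
qed

lemma F_measurable [measurable]: "(\<lambda>\<omega>. F \<omega> t) \<in> borel_measurable M"
  unfolding F_eq by measurable

lemma F_bounds: "0 \<le> F \<omega> t" "F \<omega> t \<le> 1"
proof -
  have "(\<Sum>i\<in>(UNIV::'n set). of_bool (U i \<omega> \<le> t)) \<le> (\<Sum>i\<in>(UNIV::'n set). 1::real)"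
    by (intro sum_mono) auto
  thus "F \<omega> t \<le> 1" by (simp add: F_eq)
qed (simp add: F_eq sum_nonneg)

text \<open>The left-hand side is the variance of an average, that is, the average of all pairwise
  covariances: at most \<open>1 \<le> 3\<close> on the diagonal, and at most \<open>3 \<bar>C\<^sub>i\<^sub>j\<bar>\<close> off it.\<close>

lemma mean_square_deviation_at_le:
  assumes t: "0 \<le> t" "t \<le> 1"
  shows "expectation (\<lambda>\<omega>. (F \<omega> t - t)\<^sup>2) \<le> 3 * ((CARD('n) + off_diagonal_sum C) / (real CARD('n))\<^sup>2)"
proof -
  let ?n = "real CARD('n)"
  define Y :: "'n \<Rightarrow> 'a \<Rightarrow> real" where "Y i \<omega> = of_bool (U i \<omega> \<le> t) - t" for i \<omega>
  have [measurable]: "Y i \<in> borel_measurable M" for i unfolding Y_def by measurable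
  have F_centred: "F \<omega> t - t = (\<Sum>i\<in>UNIV. Y i \<omega>) / ?n" for \<omega>
    by (simp add: F_eq Y_def sum_subtractf diff_divide_distrib)
  have sq: "(F \<omega> t - t)\<^sup>2 = (\<Sum>(i, j)\<in>UNIV \<times> UNIV. Y i \<omega> * Y j \<omega>) / ?n\<^sup>2" for \<omega>
    unfolding F_centred power_divide by (simp add: power2_eq_square sum_product sum.cartesian_product)
  have abs_Y: "\<bar>Y i \<omega>\<bar> \<le> 1" for i \<omega> using t by (auto simp: Y_def)
  have int_YY: "integrable M (\<lambda>\<omega>. Y i \<omega> * Y j \<omega>)" for i j
    by (rule integrable_const_bound[where B=1]) (auto simp: abs_mult abs_Y mult_le_one)
  have cov: "expectation (\<lambda>\<omega>. Y i \<omega> * Y j \<omega>) \<le> (if i = j then 3 else 3 * \<bar>C $ i $ j\<bar>)" for i j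
  proof (cases "i = j")
    case True
    have "Y i \<omega> * Y j \<omega> \<le> 1" for \<omega>
      using mult_le_one[OF abs_Y[of i \<omega>] abs_ge_zero abs_Y[of j \<omega>]] by (simp add: abs_le_iff flip: abs_mult)
    hence "expectation (\<lambda>\<omega>. Y i \<omega> * Y j \<omega>) \<le> expectation (\<lambda>\<omega>. 1)"
      by (intro integral_mono int_YY) auto
    thus ?thesis using True prob_space by simp
  next
    case False
    have int_b: "integrable M (\<lambda>\<omega>. of_bool (P \<omega>) :: real)" if [measurable]: "Measurable.pred M P" for P
      by (rule integrable_const_bound[where B=1]) auto
    have E_bool: "expectation (\<lambda>\<omega>. of_bool (P \<omega>)) = prob {\<omega>\<in>space M. P \<omega>}" if [measurable]: "Measurable.pred M P" for P
    proof -
      have "expectation (\<lambda>\<omega>. of_bool (P \<omega>)) = expectation (indicat_real {\<omega>\<in>space M. P \<omega>})"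
        by (rule Bochner_Integration.integral_cong[OF refl]) (simp add: indicator_def)
      thus ?thesis by simp
    qed
    have "expectation (\<lambda>\<omega>. Y i \<omega> * Y j \<omega>) =
        expectation (\<lambda>\<omega>. of_bool (U i \<omega> \<le> t \<and> U j \<omega> \<le> t) - t * of_bool (U i \<omega> \<le> t) - t * of_bool (U j \<omega> \<le> t) + t\<^sup>2)"
      by (rule Bochner_Integration.integral_cong[OF refl]) (auto simp: Y_def algebra_simps power2_eq_square)
    also have "\<dots> = prob {\<omega>\<in>space M. U i \<omega> \<le> t \<and> U j \<omega> \<le> t} - t * t - t * t + t\<^sup>2"
      by (simp add: int_b E_bool U_uniform t prob_space del: of_bool_conj)
    also have "\<dots> \<le> 3 * \<bar>C $ i $ j\<bar>"
      using U_threshold_cov[OF False t] by (simp add: power2_eq_square)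
    finally show ?thesis using False by simp
  qed
  have "expectation (\<lambda>\<omega>. (F \<omega> t - t)\<^sup>2) = (\<Sum>(i, j)\<in>UNIV \<times> UNIV. expectation (\<lambda>\<omega>. Y i \<omega> * Y j \<omega>)) / ?n\<^sup>2"
    unfolding sq using int_YY by (simp add: case_prod_beta')
  also have "(\<Sum>(i, j)\<in>UNIV \<times> UNIV. expectation (\<lambda>\<omega>. Y i \<omega> * Y j \<omega>)) \<le>
      (\<Sum>(i, j)\<in>UNIV \<times> UNIV. if i = j then 3 else 3 * \<bar>C $ i $ j\<bar>)"
    using cov by (intro sum_mono) auto
  also have "\<dots> = (\<Sum>(i, j)\<in>{(i :: 'n, j). i = j}. 3) + (\<Sum>(i, j)\<in>{(i, j). i \<noteq> j}. 3 * \<bar>C $ i $ j\<bar>)"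
    by (simp add: case_prod_beta' sum.If_cases Collect_neg_eq)
  also have "(\<Sum>(i, j)\<in>{(i :: 'n, j). i = j}. 3 :: real) = 3 * CARD('n)"
  proof -
    have "{(i, j). i = j} = (\<lambda>i::'n. (i, i)) ` UNIV" by auto
    hence "card {(i :: 'n, j). i = j} = CARD('n)" by (simp add: card_image inj_on_def)
    thus ?thesis by (simp add: case_prod_beta')
  qed
  also have "(\<Sum>(i, j)\<in>{(i, j). i \<noteq> j}. 3 * \<bar>C $ i $ j\<bar>) = 3 * off_diagonal_sum C"
    by (simp add: off_diagonal_sum_def sum_distrib_left case_prod_beta')
  finally show ?thesis by (simp add: divide_right_mono algebra_simps add_divide_distrib)
qed

section \<open>Uniform deviation\<close>

text \<open>The clamped identity in place of the mean of \<open>F\<close> is justified by \<open>expectation_F\<close>.\<close>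

definition deviation :: "'a \<Rightarrow> real" where
  "deviation \<omega> = (SUP t. \<bar>F \<omega> t - min 1 (max 0 t)\<bar>)"

lemma abs_deviation_at_le_1: "\<bar>F \<omega> t - min 1 (max 0 t)\<bar> \<le> 1"
  using F_bounds[of \<omega> t] by (auto simp: min_def max_def abs_le_iff)

lemma bdd_above_deviation: "bdd_above ((\<lambda>t. \<bar>F \<omega> t - min 1 (max 0 t)\<bar>) ` T)"
  using abs_deviation_at_le_1 by (auto simp: bdd_above_def)

lemma deviation_bounds: "0 \<le> deviation \<omega>" "deviation \<omega> \<le> 1"
proof -
  have "0 \<le> \<bar>F \<omega> 0 - min 1 (max 0 0)\<bar>" by simp
  also have "\<dots> \<le> deviation \<omega>"
    unfolding deviation_def by (rule cSUP_upper[OF _ bdd_above_deviation]) simp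
  finally show "0 \<le> deviation \<omega>" .
  show "deviation \<omega> \<le> 1"
    unfolding deviation_def by (rule cSUP_least) (auto simp: abs_deviation_at_le_1)
qed

lemma F_right_continuous: "(F \<omega> \<longlongrightarrow> F \<omega> t) (at_right t)"
proof -
  have "((\<lambda>y. of_bool (c \<le> y) :: real) \<longlongrightarrow> of_bool (c \<le> t)) (at_right t)" for c :: real
  proof (cases "c \<le> t")
    case True
    thus ?thesis
      by (intro tendsto_eventually) (auto simp: eventually_at_filter intro!: always_eventually)
  next
    case False
    hence "\<forall>\<^sub>F y in at_right t. y < c"
      by (intro eventually_at_rightI[of t c]) auto
    thus ?thesis using False
      by (intro tendsto_eventually) (auto elim: eventually_mono)
  qed
  thus ?thesis unfolding F_eq by (intro tendsto_intros) auto
qed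

text \<open>A supremum over uncountably many points need not be measurable. Here right continuity reduces it to
  the rationals.\<close>

lemma deviation_eq_SUP_rat: "deviation \<omega> = (SUP q\<in>\<rat>. \<bar>F \<omega> q - min 1 (max 0 q)\<bar>)"
proof (rule antisym)
  let ?h = "\<lambda>t. \<bar>F \<omega> t - min 1 (max 0 t)\<bar>"
  let ?S = "SUP q\<in>\<rat>. ?h q"
  have "?h t \<le> ?S" for t
  proof (rule ccontr)
    assume "\<not> ?h t \<le> ?S"
    moreover have "(?h \<longlongrightarrow> ?h t) (at_right t)"
      by (intro tendsto_intros F_right_continuous)
    ultimately have "\<forall>\<^sub>F y in at_right t. ?S < ?h y"
      by (intro order_tendstoD(1)) auto
    then obtain b where b: "b > t" "\<And>y. t < y \<Longrightarrow> y < b \<Longrightarrow> ?S < ?h y"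
      by (auto simp: eventually_at_right_field)
    obtain q where "q \<in> \<rat>" "t < q" "q < b"
      using Rats_dense_in_real[OF b(1)] by blast
    hence "?h q \<le> ?S" by (intro cSUP_upper bdd_above_deviation)
    thus False using b(2)[of q] \<open>t < q\<close> \<open>q < b\<close> by simp
  qed
  thus "deviation \<omega> \<le> ?S" unfolding deviation_def by (intro cSUP_least) auto
  show "?S \<le> deviation \<omega>"
    unfolding deviation_def by (intro cSUP_subset_mono bdd_above_deviation) auto
qed

lemma deviation_measurable [measurable]: "deviation \<in> borel_measurable M"
proof -
  have "(\<lambda>\<omega>. SUP q\<in>\<rat>. \<bar>F \<omega> q - min 1 (max 0 q)\<bar>) \<in> borel_measurable M"
    by (intro borel_measurable_cSUP countable_rat bdd_above_deviation) measurable
  thus ?thesis by (simp add: deviation_eq_SUP_rat[abs_def])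
qed

lemma integrable_deviation: "integrable M deviation"
  by (rule integrable_const_bound[where B=1]) (auto simp: deviation_bounds)

lemma F_mono: "s \<le> t \<Longrightarrow> F \<omega> s \<le> F \<omega> t"
  unfolding F_eq by (intro divide_right_mono sum_mono) auto

text \<open>Between neighbouring grid points both \<open>F\<close> and its mean are monotone, and the mean increases by
  only \<open>1 / m\<close>.\<close>

lemma deviation_le_grid:
  assumes m: "m > 0" and grid: "\<And>k::nat. k \<le> m \<Longrightarrow> \<bar>F \<omega> (k / m) - k / m\<bar> \<le> b"
  shows "deviation \<omega> \<le> 1 / real m + b"
  unfolding deviation_def
proof (rule cSUP_least)
  fix t :: real
  have b: "0 \<le> b" using grid[of 0] by (rule order_trans[OF abs_ge_zero]) simp
  consider "t < 0" | "0 \<le> t" "t < 1" | "1 \<le> t" by linarith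
  thus "\<bar>F \<omega> t - min 1 (max 0 t)\<bar> \<le> 1 / real m + b"
  proof cases
    case 1
    hence "F \<omega> t = 0" using less_le_trans[OF _ U_bounds(1)] by (simp add: F_eq not_le)
    thus ?thesis using 1 b by simp
  next
    case 3
    hence "F \<omega> t = 1" using order_trans[OF U_bounds(2)] by (simp add: F_eq)
    thus ?thesis using 3 b by simp
  next
    case 2
    define k where "k = nat \<lfloor>t * m\<rfloor>"
    have "real k \<le> t * m" "t * m < real k + 1"
      using 2 by (simp_all add: k_def of_nat_nat)
    moreover from this have "k < m"
    proof -
      have "t * m < real m" using 2 m by simp
      thus ?thesis using \<open>real k \<le> t * m\<close> by linarith
    qed
    ultimately have k: "k < m" "k / m \<le> t" "t \<le> Suc k / m" "Suc k / m = k / m + 1 / m"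
      using m by (auto simp: field_simps)
    have "F \<omega> (k / m) \<le> F \<omega> t" "F \<omega> t \<le> F \<omega> (Suc k / m)"
      using k by (auto intro!: F_mono)
    thus ?thesis
      using grid[of k] grid[of "Suc k"] k 2 by (simp add: abs_le_iff)
  qed
qed simp

text \<open>On a grid of mesh \<open>1 / m\<close> the maximum of the deviations \<open>d\<^sub>k\<close> is bounded through
  \<open>\<bar>d\<bar> \<le> a / 2 + d\<^sup>2 / (2 a)\<close> by the sum of their squares, whose expectation is at most \<open>(m + 1) 3 a\<^sup>3\<close>.
  With \<open>m\<close> of order \<open>1 / a\<close>, the mesh and the grid terms are both of order \<open>a\<close>, which explains the
  cube root: the total is \<open>a + a / 2 + 9 a / 2\<close>. For \<open>a > 1\<close> the claim is trivial.\<close>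

lemma expectation_deviation_le:
  fixes a :: real
  assumes a: "0 < a" "a ^ 3 = (CARD('n) + off_diagonal_sum C) / (real CARD('n))\<^sup>2"
  shows "expectation deviation \<le> 6 * a"
proof (cases "a \<le> 1")
  case False
  have "expectation deviation \<le> expectation (\<lambda>_. 1)"
    by (intro integral_mono integrable_deviation deviation_bounds) auto
  thus ?thesis using False prob_space by simp
next
  case True
  define m where "m = nat \<lceil>1 / a\<rceil>"
  have m: "1 / a \<le> m" "m \<le> 1 / a + 1" "m > 0"
    using a by (auto simp: m_def of_nat_nat less_imp_le)
  let ?d = "\<lambda>k \<omega>. F \<omega> (real k / m) - k / m"
  have int_d: "integrable M (\<lambda>\<omega>. (?d k \<omega>)\<^sup>2)" if "k \<le> m" for k
  proof (rule integrable_const_bound[where B=1])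
    have "\<bar>?d k \<omega>\<bar> \<le> 1" for \<omega>
    proof -
      have "0 \<le> real k / m" "real k / m \<le> 1" using that m by (auto simp: divide_le_eq)
      thus ?thesis using F_bounds[of \<omega> "k / m"] by linarith
    qed
    thus "AE \<omega> in M. norm ((?d k \<omega>)\<^sup>2) \<le> 1"
      by (simp add: abs_square_le_1)
  qed measurable
  have pointwise: "deviation \<omega> \<le> 1 / m + (a / 2 + (\<Sum>k\<le>m. (?d k \<omega>)\<^sup>2) / (2 * a))" for \<omega>
  proof (rule deviation_le_grid)
    fix k assume "k \<le> m"
    hence "(?d k \<omega>)\<^sup>2 \<le> (\<Sum>k\<le>m. (?d k \<omega>)\<^sup>2)"
      by (intro member_le_sum) auto
    moreover have "2 * a * \<bar>?d k \<omega>\<bar> \<le> a\<^sup>2 + (?d k \<omega>)\<^sup>2"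
      using sum_squares_bound[of a "\<bar>?d k \<omega>\<bar>"] by simp
    ultimately have "\<bar>?d k \<omega>\<bar> * (2 * a) \<le> a\<^sup>2 + (\<Sum>k\<le>m. (?d k \<omega>)\<^sup>2)"
      by (simp add: mult.commute mult.left_commute)
    hence "\<bar>?d k \<omega>\<bar> \<le> (a\<^sup>2 + (\<Sum>k\<le>m. (?d k \<omega>)\<^sup>2)) / (2 * a)"
      using a by (subst pos_le_divide_eq) auto
    also have "\<dots> = a / 2 + (\<Sum>k\<le>m. (?d k \<omega>)\<^sup>2) / (2 * a)"
      using a by (simp add: add_divide_distrib power2_eq_square)
    finally show "\<bar>?d k \<omega>\<bar> \<le> a / 2 + (\<Sum>k\<le>m. (?d k \<omega>)\<^sup>2) / (2 * a)" .
  qed (rule m)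
  have int_sum: "integrable M (\<lambda>\<omega>. \<Sum>k\<le>m. (?d k \<omega>)\<^sup>2)"
    by (intro Bochner_Integration.integrable_sum int_d) auto
  have "expectation deviation \<le> expectation (\<lambda>\<omega>. 1 / m + (a / 2 + (\<Sum>k\<le>m. (?d k \<omega>)\<^sup>2) / (2 * a)))"
    by (intro integral_mono integrable_deviation pointwise Bochner_Integration.integrable_add
        integrable_divide_zero int_sum integrable_const)
  also have "\<dots> = 1 / m + (a / 2 + (\<Sum>k\<le>m. expectation (\<lambda>\<omega>. (?d k \<omega>)\<^sup>2)) / (2 * a))"
    using int_sum int_d prob_space by (simp add: Bochner_Integration.integral_sum)
  also have "\<dots> \<le> a + (a / 2 + 9 * a\<^sup>2 / (2 * a))"
  proof (intro add_mono divide_right_mono order_refl)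
    show "1 / real m \<le> a" using m a by (simp add: field_simps)
    have "(\<Sum>k\<le>m. expectation (\<lambda>\<omega>. (?d k \<omega>)\<^sup>2)) \<le> (\<Sum>k\<le>m. 3 * a ^ 3)"
      unfolding a(2) using m by (intro sum_mono mean_square_deviation_at_le) (auto simp: divide_le_eq)
    also have "\<dots> = (real m + 1) * (3 * a ^ 3)" by simp
    also have "\<dots> \<le> (3 / a) * (3 * a ^ 3)"
    proof (rule mult_right_mono)
      have "1 \<le> 1 / a" using a True by simp
      thus "real m + 1 \<le> 3 / a" using m(2) by simp
    qed (use a(1) in simp)
    also have "\<dots> = 9 * a\<^sup>2" using a(1) by (simp add: power2_eq_square power3_eq_cube)
    finally show "(\<Sum>k\<le>m. expectation (\<lambda>\<omega>. (?d k \<omega>)\<^sup>2)) \<le> 9 * a\<^sup>2" .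
  qed (use a(1) in simp_all)
  also have "\<dots> = 6 * a" using a(1) by (simp add: power2_eq_square)
  finally show ?thesis .
qed

end

theorem theorem3:
  fixes M :: "'a measure" and X :: "'a \<Rightarrow> real ^ 'n" and C :: "real ^ 'n ^ 'n"
  assumes "prob_space M"
    and "gaussian_vector M X 0 C"
    and "\<And>i. C $ i $ i = 1"
  defines "D \<equiv> \<lambda>\<omega>. (SUP t. \<bar>empirical_cdf X \<omega> t - (\<integral>\<omega>'. empirical_cdf X \<omega>' t \<partial>M)\<bar>)"
  shows "integrable M D \<and>
    (\<integral>\<omega>. D \<omega> \<partial>M) \<le> 16 * root 3 ((real CARD('n) + off_diagonal_sum C) / (real CARD('n))\<^sup>2)"
proof -
  interpret prob_space M by fact
  interpret standardised_gaussian_vector M X C by standard fact+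
  have D: "D = deviation"
    using expectation_F by (simp add: D_def deviation_def[abs_def])
  let ?A = "(real CARD('n) + off_diagonal_sum C) / (real CARD('n))\<^sup>2"
  have "0 \<le> off_diagonal_sum C"
    by (auto simp: off_diagonal_sum_def intro!: sum_nonneg)
  hence "0 < ?A" by (simp add: add_pos_nonneg)
  hence root: "0 < root 3 ?A" "root 3 ?A ^ 3 = ?A"
    by (simp_all only: real_root_gt_zero real_root_pow_pos2 less_imp_le zero_less_numeral)
  hence "(\<integral>\<omega>. D \<omega> \<partial>M) \<le> 6 * root 3 ?A"
    unfolding D by (rule expectation_deviation_le)
  also have "\<dots> \<le> 16 * root 3 ?A" using root(1) by linarith
  finally have "(\<integral>\<omega>. D \<omega> \<partial>M) \<le> 16 * root 3 ?A" .
  thus ?thesis using integrable_deviation D by simp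
qed

end
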